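(* Let $g\in L^2(\Omega)$, $\alpha>0$, let $u\in BV(\Omega)\cap L^2(\Omega)$ be the unique minimizer of $$I(v):=|\mathrm{D}v|(\Omega)+\tfrac{\alpha}{2}\|v-g\|^2_{L^2(\Omega)},\qquad v\in BV(\Omega)\cap L^2(\Omega),$$ and let $z\in W^2_N(\mathrm{div};\Omega)\cap L^\infty(\Omega;\mathbb{R}^d)$ be a maximizer of $$D(y):=-I_{K_1(0)}(y)-\tfrac{1}{2\alpha}\|\mathrm{div}\,y+\alpha g\|^2_{L^2(\Omega)}+\tfrac{\alpha}{2}\|g\|^2_{L^2(\Omega)},\qquad y\in W^2_N(\mathrm{div};\Omega)\cap L^\infty(\Omega;\mathbb{R}^d).$$ Set $\rho_I^2(v,u):=I(v)-I(u)$, $\rho_{-D}^2(y,z):=D(z)-D(y)$ and $\eta^2(v,y):=I(v)-D(y)$. Then: (i) For every $v\in BV(\Omega)\cap L^2(\Omega)$ and $y\in W^2_N(\mathrm{div};\Omega)\cap L^\infty(\Omega;\mathbb{R}^d)$, $$\rho_I^2(v,u)+\rho_{-D}^2(y,z)=\eta^2(v,y).$$ (ii) For every $v\in BV(\Omega)\cap L^2(\Omega)$ and $y\in W^2_N(\mathrm{div};\Omega)\cap L^\infty(\Omega;\mathbb{R}^d)$, $$\eta^2(v,y)=|\mathrm{D}v|(\Omega)+(\mathrm{div}\,y,v)_\Omega+\tfrac{1}{2\alpha}\|\mathrm{div}\,y-\alpha(v-g)\|^2_{L^2(\Omega)}+I_{K_1(0)}(y).$$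
   Context: $\Omega\subseteq\mathbb{R}^d$, $d\in\mathbb{N}$, is a bounded polyhedral Lipschitz domain, with $\Gamma_D=\emptyset$ and $\Gamma_N=\partial\Omega$. $|\mathrm{D}v|(\Omega)$ is the total variation of $v$, and $BV(\Omega)$ is the space of $v\in L^1(\Omega)$ with $|\mathrm{D}v|(\Omega)<\infty$. $W^2_N(\mathrm{div};\Omega)$ is the space of $y\in L^2(\Omega;\mathbb{R}^d)$ with $\mathrm{div}\,y\in L^2(\Omega)$ and vanishing normal trace on $\partial\Omega$. $I_{K_1(0)}(y):=0$ if $|y|\le1$ a.e. in $\Omega$ and $I_{K_1(0)}(y):=+\infty$ otherwise. $(\cdot,\cdot)_\Omega$ is the $L^2(\Omega)$ inner product. Known facts forming part of the setting: $I$ has a unique minimizer $u$, $D$ has a (possibly non-unique) maximizer $z$, and strong duality $I(u)=D(z)$ holds. *)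

theory Defs
  imports "HOL-Analysis.Analysis"
begin

section \<open>Domains\<close>

text \<open>Near each boundary point, the domain is the part of a ball lying above the graph, in some
  unit direction \<open>e\<close>, of a Lipschitz function \<open>h\<close> on the hyperplane orthogonal to \<open>e\<close>.\<close>

definition lipschitz_boundary :: "'a::euclidean_space set \<Rightarrow> bool" where
  "lipschitz_boundary \<Omega> \<longleftrightarrow>
     (\<forall>x\<^sub>0\<in>frontier \<Omega>. \<exists>e r L h. norm e = 1 \<and> 0 < r \<and> L-lipschitz_on {x. x \<bullet> e = 0} h \<and>
        \<Omega> \<inter> ball x\<^sub>0 r = {x \<in> ball x\<^sub>0 r. h (x - (x \<bullet> e) *\<^sub>R e) < x \<bullet> e})"

definition polyhedral :: "'a::euclidean_space set \<Rightarrow> bool" where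
  "polyhedral \<Omega> \<longleftrightarrow> (\<exists>\<P>. finite \<P> \<and> (\<forall>P\<in>\<P>. polytope P) \<and> closure \<Omega> = \<Union>\<P>)"

definition bounded_polyhedral_lipschitz_domain :: "'a::euclidean_space set \<Rightarrow> bool" where
  "bounded_polyhedral_lipschitz_domain \<Omega> \<longleftrightarrow>
     open \<Omega> \<and> connected \<Omega> \<and> \<Omega> \<noteq> {} \<and> bounded \<Omega> \<and> polyhedral \<Omega> \<and> lipschitz_boundary \<Omega>"

section \<open>Test functions\<close>

primrec Ck :: "nat \<Rightarrow> ('a::euclidean_space \<Rightarrow> 'b::real_normed_vector) \<Rightarrow> bool" where
  "Ck 0 f \<longleftrightarrow> continuous_on UNIV f"
| "Ck (Suc k) f \<longleftrightarrow>
     f differentiable_on UNIV \<and> (\<forall>b\<in>Basis. Ck k (\<lambda>x. frechet_derivative f (at x) b))"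

text \<open>\<open>C\<^sub>c\<^sup>\<infinity>(\<Omega>)\<close>: elements are extended by zero to the whole space.\<close>

definition test_functions :: "'a::euclidean_space set \<Rightarrow> ('a \<Rightarrow> 'b::real_normed_vector) set" where
  "test_functions \<Omega> =
     {\<phi>. (\<forall>k. Ck k \<phi>) \<and> compact (closure {x. \<phi> x \<noteq> 0}) \<and> closure {x. \<phi> x \<noteq> 0} \<subseteq> \<Omega>}"

definition gradient :: "('a::euclidean_space \<Rightarrow> real) \<Rightarrow> 'a \<Rightarrow> 'a" where
  "gradient \<phi> x = (\<Sum>b\<in>Basis. frechet_derivative \<phi> (at x) b *\<^sub>R b)"

definition divergence :: "('a::euclidean_space \<Rightarrow> 'a) \<Rightarrow> 'a \<Rightarrow> real" where
  "divergence \<phi> x = (\<Sum>b\<in>Basis. frechet_derivative \<phi> (at x) b \<bullet> b)"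

section \<open>Lebesgue spaces\<close>

text \<open>Elements of all function spaces below are functions on the whole space, of which only the
  values on \<open>\<Omega>\<close> up to null sets matter; they are not identified with their equivalence classes.\<close>

definition L2 :: "'a::euclidean_space set \<Rightarrow> ('a \<Rightarrow> 'b::euclidean_space) set" where
  "L2 \<Omega> = {f \<in> borel_measurable (lebesgue_on \<Omega>).
             integrable (lebesgue_on \<Omega>) (\<lambda>x. (norm (f x))\<^sup>2)}"

definition Linfty :: "'a::euclidean_space set \<Rightarrow> ('a \<Rightarrow> 'b::euclidean_space) set" where
  "Linfty \<Omega> = {f \<in> borel_measurable (lebesgue_on \<Omega>).
                 \<exists>C. AE x in lebesgue_on \<Omega>. norm (f x) \<le> C}"

definition L2_inner ::
    "'a::euclidean_space set \<Rightarrow> ('a \<Rightarrow> 'b::euclidean_space) \<Rightarrow> ('a \<Rightarrow> 'b) \<Rightarrow> real" where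
  "L2_inner \<Omega> f h = (LINT x|lebesgue_on \<Omega>. f x \<bullet> h x)"

definition L2_norm :: "'a::euclidean_space set \<Rightarrow> ('a \<Rightarrow> 'b::euclidean_space) \<Rightarrow> real" where
  "L2_norm \<Omega> f = sqrt (LINT x|lebesgue_on \<Omega>. (norm (f x))\<^sup>2)"

section \<open>Functions of bounded variation\<close>

definition total_variation :: "'a::euclidean_space set \<Rightarrow> ('a \<Rightarrow> real) \<Rightarrow> ereal" where
  "total_variation \<Omega> v =
     (SUP \<phi> \<in> {\<phi> \<in> test_functions \<Omega>. \<forall>x. norm (\<phi> x) \<le> 1}.
        ereal (- (LINT x|lebesgue_on \<Omega>. v x * divergence \<phi> x)))"

definition BV :: "'a::euclidean_space set \<Rightarrow> ('a \<Rightarrow> real) set" where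
  "BV \<Omega> = {v. integrable (lebesgue_on \<Omega>) v \<and> total_variation \<Omega> v < \<infinity>}"

section \<open>Weak derivatives in L2 and the normal trace\<close>

definition is_weak_gradient ::
    "'a::euclidean_space set \<Rightarrow> ('a \<Rightarrow> real) \<Rightarrow> ('a \<Rightarrow> 'a) \<Rightarrow> bool" where
  "is_weak_gradient \<Omega> w p \<longleftrightarrow> p \<in> L2 \<Omega> \<and>
     (\<forall>\<phi> \<in> test_functions \<Omega>. L2_inner \<Omega> w (divergence \<phi>) = - L2_inner \<Omega> p \<phi>)"

definition is_weak_divergence ::
    "'a::euclidean_space set \<Rightarrow> ('a \<Rightarrow> 'a) \<Rightarrow> ('a \<Rightarrow> real) \<Rightarrow> bool" where
  "is_weak_divergence \<Omega> y q \<longleftrightarrow> q \<in> L2 \<Omega> \<and>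
     (\<forall>\<phi> \<in> test_functions \<Omega>. L2_inner \<Omega> y (gradient \<phi>) = - L2_inner \<Omega> q \<phi>)"

text \<open>Weak gradients and divergences are determined up to null sets only, so the operators select a
  representative; they are meaningful on \<open>W12\<close> and \<open>W2_div\<close>, respectively.\<close>

definition weak_gradient :: "'a::euclidean_space set \<Rightarrow> ('a \<Rightarrow> real) \<Rightarrow> 'a \<Rightarrow> 'a" where
  "weak_gradient \<Omega> w = (SOME p. is_weak_gradient \<Omega> w p)"

definition weak_divergence :: "'a::euclidean_space set \<Rightarrow> ('a \<Rightarrow> 'a) \<Rightarrow> 'a \<Rightarrow> real" where
  "weak_divergence \<Omega> y = (SOME q. is_weak_divergence \<Omega> y q)"

definition W12 :: "'a::euclidean_space set \<Rightarrow> ('a \<Rightarrow> real) set" where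
  "W12 \<Omega> = {w \<in> L2 \<Omega>. \<exists>p. is_weak_gradient \<Omega> w p}"

definition W2_div :: "'a::euclidean_space set \<Rightarrow> ('a \<Rightarrow> 'a) set" where
  "W2_div \<Omega> = {y \<in> L2 \<Omega>. \<exists>q. is_weak_divergence \<Omega> y q}"

text \<open>The normal trace of a field in \<open>W2_div\<close> is not a function on the boundary but the functional
  on (traces of) \<open>W12\<close> given by Green's formula
  \<open>\<langle>y \<cdot> n, w\<rangle> = (y, \<nabla>w) + (div y, w)\<close>. As the Neumann part is the whole boundary, it is tested
  with all of \<open>W12\<close>.\<close>

definition normal_trace ::
    "'a::euclidean_space set \<Rightarrow> ('a \<Rightarrow> 'a) \<Rightarrow> ('a \<Rightarrow> real) \<Rightarrow> real" where
  "normal_trace \<Omega> y w = L2_inner \<Omega> y (weak_gradient \<Omega> w) + L2_inner \<Omega> (weak_divergence \<Omega> y) w"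

definition W2N_div :: "'a::euclidean_space set \<Rightarrow> ('a \<Rightarrow> 'a) set" where
  "W2N_div \<Omega> = {y \<in> W2_div \<Omega>. \<forall>w \<in> W12 \<Omega>. normal_trace \<Omega> y w = 0}"

section \<open>Primal and dual functionals\<close>

definition indicator_K1 :: "'a::euclidean_space set \<Rightarrow> ('a \<Rightarrow> 'a) \<Rightarrow> ereal" where
  "indicator_K1 \<Omega> y = (if AE x in lebesgue_on \<Omega>. norm (y x) \<le> 1 then 0 else \<infinity>)"

definition primal_energy ::
    "'a::euclidean_space set \<Rightarrow> real \<Rightarrow> ('a \<Rightarrow> real) \<Rightarrow> ('a \<Rightarrow> real) \<Rightarrow> ereal" where
  "primal_energy \<Omega> \<alpha> g v =
     total_variation \<Omega> v + ereal (\<alpha> / 2 * (L2_norm \<Omega> (\<lambda>x. v x - g x))\<^sup>2)"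

definition dual_energy ::
    "'a::euclidean_space set \<Rightarrow> real \<Rightarrow> ('a \<Rightarrow> real) \<Rightarrow> ('a \<Rightarrow> 'a) \<Rightarrow> ereal" where
  "dual_energy \<Omega> \<alpha> g y =
     - indicator_K1 \<Omega> y
     - ereal (1 / (2 * \<alpha>) * (L2_norm \<Omega> (\<lambda>x. weak_divergence \<Omega> y x + \<alpha> * g x))\<^sup>2)
     + ereal (\<alpha> / 2 * (L2_norm \<Omega> g)\<^sup>2)"

definition rho_primal_sq ::
    "'a::euclidean_space set \<Rightarrow> real \<Rightarrow> ('a \<Rightarrow> real) \<Rightarrow> ('a \<Rightarrow> real) \<Rightarrow> ('a \<Rightarrow> real) \<Rightarrow> ereal" where
  "rho_primal_sq \<Omega> \<alpha> g v u = primal_energy \<Omega> \<alpha> g v - primal_energy \<Omega> \<alpha> g u"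

definition rho_dual_sq ::
    "'a::euclidean_space set \<Rightarrow> real \<Rightarrow> ('a \<Rightarrow> real) \<Rightarrow> ('a \<Rightarrow> 'a) \<Rightarrow> ('a \<Rightarrow> 'a) \<Rightarrow> ereal" where
  "rho_dual_sq \<Omega> \<alpha> g y z = dual_energy \<Omega> \<alpha> g z - dual_energy \<Omega> \<alpha> g y"

definition eta_sq ::
    "'a::euclidean_space set \<Rightarrow> real \<Rightarrow> ('a \<Rightarrow> real) \<Rightarrow> ('a \<Rightarrow> real) \<Rightarrow> ('a \<Rightarrow> 'a) \<Rightarrow> ereal" where
  "eta_sq \<Omega> \<alpha> g v y = primal_energy \<Omega> \<alpha> g v - dual_energy \<Omega> \<alpha> g y"

end

theory Submission
  imports Defs
begin

text \<open>Strong duality makes the dual value of \<open>z\<close> finite, so it cancels against the primal value of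
  \<open>u\<close> in (i). Given \<open>div y \<in> L\<^sup>2(\<Omega>)\<close>, (ii) is the integral of the pointwise identity
  \<open>\<alpha>/2 (v - g)\<^sup>2 + 1/(2\<alpha>) (q + \<alpha> g)\<^sup>2 - \<alpha>/2 g\<^sup>2 = q v + 1/(2\<alpha>) (q - \<alpha> (v - g))\<^sup>2\<close>.\<close>

lemma Ck_zero: "Ck k (\<lambda>x::'a::euclidean_space. 0::'b::real_normed_vector)"
  by (induction k) (simp_all add: frechet_derivative_const)

lemma zero_in_test_functions: "(\<lambda>x. 0) \<in> test_functions \<Omega>"
  by (simp add: test_functions_def Ck_zero)

text \<open>The zero field is admissible in the supremum and contributes the value 0; this rules out
  the value minus infinity.\<close>

lemma total_variation_nonneg: "0 \<le> total_variation \<Omega> v"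
  unfolding total_variation_def
  by (rule SUP_upper2[of "\<lambda>x. 0"])
    (simp_all add: zero_in_test_functions divergence_def frechet_derivative_const)

text \<open>Lets calculations in \<open>ereal\<close> be carried out with a real number, where
  subtraction and cancellation behave as usual.\<close>

lemma total_variation_finite_on_BV:
  assumes "v \<in> BV \<Omega>"
  obtains t where "total_variation \<Omega> v = ereal t"
  using assms total_variation_nonneg[of \<Omega> v] by (cases "total_variation \<Omega> v") (auto simp: BV_def)

lemma L2_norm_power2: "(L2_norm \<Omega> f)\<^sup>2 = (LINT x|lebesgue_on \<Omega>. (norm (f x))\<^sup>2)"
  by (simp add: L2_norm_def)

text \<open>By Cauchy-Schwarz and \<open>2 * a * b \<le> a\<^sup>2 + b\<^sup>2\<close>, the product
  is dominated by the sum of the two integrable squares.\<close>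

lemma integrable_inner_L2:
  assumes "f \<in> L2 \<Omega>" "h \<in> L2 \<Omega>"
  shows "integrable (lebesgue_on \<Omega>) (\<lambda>x. f x \<bullet> h x)"
proof (rule Bochner_Integration.integrable_bound)
  show "integrable (lebesgue_on \<Omega>) (\<lambda>x. (norm (f x))\<^sup>2 + (norm (h x))\<^sup>2)"
    using assms by (simp add: L2_def)
  show "(\<lambda>x. f x \<bullet> h x) \<in> borel_measurable (lebesgue_on \<Omega>)"
    using assms by (auto simp: L2_def)
  have "norm (a \<bullet> b) \<le> norm ((norm a)\<^sup>2 + (norm b)\<^sup>2)" for a b :: 'b
  proof -
    have "\<bar>a \<bullet> b\<bar> \<le> norm a * norm b" by (rule Cauchy_Schwarz_ineq2)
    also have "\<dots> \<le> 2 * norm a * norm b" by simp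
    also have "\<dots> \<le> (norm a)\<^sup>2 + (norm b)\<^sup>2" by (rule sum_squares_bound)
    finally show ?thesis by simp
  qed
  then show "AE x in lebesgue_on \<Omega>. norm (f x \<bullet> h x) \<le> norm ((norm (f x))\<^sup>2 + (norm (h x))\<^sup>2)"
    by simp
qed

text \<open>Membership in \<open>W2_div\<close> supplies the witness that makes the choice by
  \<open>SOME\<close> meaningful.\<close>

lemma weak_divergence_in_L2:
  assumes "y \<in> W2_div \<Omega>"
  shows "weak_divergence \<Omega> y \<in> L2 \<Omega>"
proof -
  have "is_weak_divergence \<Omega> y (weak_divergence \<Omega> y)"
    unfolding weak_divergence_def
    by (rule someI_ex[of "is_weak_divergence \<Omega> y"]) (use assms in \<open>simp add: W2_div_def\<close>)
  then show ?thesis by (simp add: is_weak_divergence_def)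
qed

text \<open>The finite, real-valued core of (ii), with \<open>q\<close> in the place of the weak
  divergence of \<open>y\<close>.\<close>

lemma quadratic_gap_identity:
  fixes q v g :: "'a::euclidean_space \<Rightarrow> real"
  assumes q: "q \<in> L2 \<Omega>" and v: "v \<in> L2 \<Omega>" and g: "g \<in> L2 \<Omega>" and \<alpha>: "\<alpha> \<noteq> 0"
  shows "\<alpha> / 2 * (L2_norm \<Omega> (\<lambda>x. v x - g x))\<^sup>2
      + 1 / (2 * \<alpha>) * (L2_norm \<Omega> (\<lambda>x. q x + \<alpha> * g x))\<^sup>2 - \<alpha> / 2 * (L2_norm \<Omega> g)\<^sup>2
    = L2_inner \<Omega> q v + 1 / (2 * \<alpha>) * (L2_norm \<Omega> (\<lambda>x. q x - \<alpha> * (v x - g x)))\<^sup>2"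
proof -
  \<comment> \<open>Splitting an integral of a sum requires each summand to be integrable, since the
    integral of a non-integrable function is 0 by default. These are all the pairwise products of
    \<open>q\<close>, \<open>v\<close> and \<open>g\<close>.\<close>
  note [simp] = integrable_inner_L2[OF q q, simplified] integrable_inner_L2[OF q v, simplified]
    integrable_inner_L2[OF q g, simplified] integrable_inner_L2[OF v v, simplified]
    integrable_inner_L2[OF v g, simplified] integrable_inner_L2[OF g g, simplified]
  \<comment> \<open>Written in the six products, both sides become linear combinations of the same
    six integrals, and comparing coefficients suffices.\<close>
  have expand: "(v x - g x)\<^sup>2 = v x * v x - 2 * (v x * g x) + g x * g x"
    "(q x + \<alpha> * g x)\<^sup>2 = q x * q x + 2 * \<alpha> * (q x * g x) + \<alpha>\<^sup>2 * (g x * g x)"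
    "(q x - \<alpha> * (v x - g x))\<^sup>2 = q x * q x - 2 * \<alpha> * (q x * v x) + 2 * \<alpha> * (q x * g x)
       + \<alpha>\<^sup>2 * (v x * v x) - 2 * \<alpha>\<^sup>2 * (v x * g x) + \<alpha>\<^sup>2 * (g x * g x)"
    "(g x)\<^sup>2 = g x * g x" for x
    by algebra+
  show ?thesis
    unfolding L2_norm_power2 L2_inner_def real_norm_def power2_abs inner_real_def expand
    using \<alpha> by simp (simp add: field_simps power2_eq_square)
qed

theorem theorem4p1:
  fixes \<Omega> :: "(real ^ 'd) set"
    and g u :: "real ^ 'd \<Rightarrow> real"
    and z :: "real ^ 'd \<Rightarrow> real ^ 'd"
    and \<alpha> :: real
  assumes domain: "bounded_polyhedral_lipschitz_domain \<Omega>"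
    and g: "g \<in> L2 \<Omega>"
    and \<alpha>: "0 < \<alpha>"
    and u_min: "is_arg_min (primal_energy \<Omega> \<alpha> g) (\<lambda>v. v \<in> BV \<Omega> \<inter> L2 \<Omega>) u"
    and u_unique: "\<And>w. is_arg_min (primal_energy \<Omega> \<alpha> g) (\<lambda>v. v \<in> BV \<Omega> \<inter> L2 \<Omega>) w \<Longrightarrow>
                     AE x in lebesgue_on \<Omega>. w x = u x"
    and z_max: "is_arg_max (dual_energy \<Omega> \<alpha> g) (\<lambda>y. y \<in> W2N_div \<Omega> \<inter> Linfty \<Omega>) z"
    and strong_duality: "primal_energy \<Omega> \<alpha> g u = dual_energy \<Omega> \<alpha> g z"
  shows "(\<forall>v \<in> BV \<Omega> \<inter> L2 \<Omega>. \<forall>y \<in> W2N_div \<Omega> \<inter> Linfty \<Omega>.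
            rho_primal_sq \<Omega> \<alpha> g v u + rho_dual_sq \<Omega> \<alpha> g y z = eta_sq \<Omega> \<alpha> g v y) \<and>
         (\<forall>v \<in> BV \<Omega> \<inter> L2 \<Omega>. \<forall>y \<in> W2N_div \<Omega> \<inter> Linfty \<Omega>.
            eta_sq \<Omega> \<alpha> g v y =
              total_variation \<Omega> v
              + ereal (L2_inner \<Omega> (weak_divergence \<Omega> y) v)
              + ereal (1 / (2 * \<alpha>) *
                  (L2_norm \<Omega> (\<lambda>x. weak_divergence \<Omega> y x - \<alpha> * (v x - g x)))\<^sup>2)
              + indicator_K1 \<Omega> y)"
proof (intro conjI ballI)
  fix v y assume v: "v \<in> BV \<Omega> \<inter> L2 \<Omega>" and y: "y \<in> W2N_div \<Omega> \<inter> Linfty \<Omega>"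
  obtain t where t: "total_variation \<Omega> v = ereal t"
    using v by (auto elim: total_variation_finite_on_BV)
  \<comment> \<open>This makes \<open>primal_energy\<close> at \<open>u\<close> finite, so that it
    may be cancelled in \<open>ereal\<close>.\<close>
  have "u \<in> BV \<Omega>"
    using u_min by (simp add: is_arg_min_def)
  then obtain s where s: "total_variation \<Omega> u = ereal s"
    by (rule total_variation_finite_on_BV)
  \<comment> \<open>If \<open>y\<close> violates the constraint, its dual energy is minus infinity
    and both sides are infinite; otherwise all terms are real.\<close>
  show "rho_primal_sq \<Omega> \<alpha> g v u + rho_dual_sq \<Omega> \<alpha> g y z = eta_sq \<Omega> \<alpha> g v y"
    unfolding rho_primal_sq_def rho_dual_sq_def eta_sq_def strong_duality[symmetric]
    by (simp add: primal_energy_def dual_energy_def indicator_K1_def t s)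
  have "weak_divergence \<Omega> y \<in> L2 \<Omega>"
    using y by (auto simp: W2N_div_def intro: weak_divergence_in_L2)
  \<comment> \<open>The total variation is the same real \<open>t\<close> on both sides, and an
    infinite indicator makes both sides infinite; what remains is the quadratic identity.\<close>
  from quadratic_gap_identity[OF this _ g, of v \<alpha>] v \<alpha>
  show "eta_sq \<Omega> \<alpha> g v y =
      total_variation \<Omega> v
      + ereal (L2_inner \<Omega> (weak_divergence \<Omega> y) v)
      + ereal (1 / (2 * \<alpha>) *
          (L2_norm \<Omega> (\<lambda>x. weak_divergence \<Omega> y x - \<alpha> * (v x - g x)))\<^sup>2)
      + indicator_K1 \<Omega> y"
    by (simp add: eta_sq_def primal_energy_def dual_energy_def indicator_K1_def t)
qed

end
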